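(* The uniform probabilistic respecting eagerness mechanism (UPRE) satisfies sd-weak-envy-freeness (sd-WEF) and strong equal treatment of equals (SETE).
   Context: Setting. An assignment problem has a set $N=\{1,\dots,n\}$ of agents and a set $M$ of $n$ items (one unit each). A preference profile $R=(\succ_j)_{j\in N}$ gives each agent $j$ a strict linear order $\succ_j$ on $M$. For nonempty $S\subseteq M$, $\mathrm{top}(j,S)$ is the $\succ_j$-best item of $S$; $rk(j,o)$ is the rank of $o$ in $\succ_j$ ($1$ = best). A random assignment is a doubly stochastic $n\times n$ matrix $P=[p_{j,o}]_{j\in N,o\in M}$, with $j$-th row $P_j$. A mechanism maps preference profiles to random assignments, and satisfies a property of random assignments if its output satisfies it for every profile. PRE mechanisms. Let $\omega=(\omega_j)_{j\in N}$ be eating speed functions $\omega_j:[0,\infty)\to[0,\infty)$ with $\int_0^1\omega_j(t)\,dt=1$ and $\omega_j(t)=0$ for $t>1$. $\mathrm{PRE}_\omega(R)$ is computed as follows. Start with $M'=M$, $P=0$, supplies $s(o)=1$ for all $o\in M$, elapsed times $t_j=0$ for all $j\in N$. While $M'\neq\emptyset$, perform a round: for each $o\in M'$ set $N_o=\{j\in N:\mathrm{top}(j,M')=o\}$; for each $o\in M'$ let $\rho_o$ be the minimum of the union of the sets $\{\rho\ge 0:\sum_{k\in N_o}\int_{t_k}^{t_k+\rho}\omega_k(t)\,dt=s(o)\}$ and $\{\rho\in[0,1]:\sum_{k\in N_o}\int_{t_k}^{t_k+\rho}\omega_k(t)\,dt=\sum_{k\in N_o}\int_{t_k}^{1}\omega_k(t)\,dt\}$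 (so the agents in $N_o$ consume $o$ until $o$ is exhausted or all of them are satisfied); each $j\in N_o$ consumes the amount $\int_{t_j}^{t_j+\rho_o}\omega_j(t)\,dt$ of $o$, which is added to $p_{j,o}$; $s(o)$ is decreased by the total amount of $o$ consumed in this round; $t_j$ is increased by $\rho_o$ for each $j\in N_o$. At the end of the round all items with $s(o)=0$ are removed from $M'$. The output is $P$. UPRE is the mechanism $\mathrm{PRE}_\omega$ with $\omega_j(t)=1$ for $t\in[0,1]$ and $\omega_j(t)=0$ for $t>1$, for every $j\in N$. Stochastic dominance. $U(\succ,o)=\{o'\in M:o'\succ o\}\cup\{o\}$. For probability vectors $p,q$ on $M$, $p\succeq^{sd}_jq$ means $\sum_{o'\in U(\succ_j,o)}p_{o'}\ge\sum_{o'\in U(\succ_j,o)}q_{o'}$ for all $o\in M$. sd-WEF: $P$ is sd-WEF if for all $j,k\in N$, $P_k\succeq^{sd}_jP_j$ implies $P_j=P_k$. SETE: for agents $j,k$, their common prefix is the set $M'\subseteq M$ such that $rk(j,o)=rk(k,o)\le|M'|$ for all $o\in M'$ and $\mathrm{top}(j,M\setminus M')\neq\mathrm{top}(k,M\setminus M')$ (with $M'=M$ if $\succ_j=\succ_k$). $P$ satisfies SETE if $p_{j,o}=p_{k,o}$ for all $j,k\in N$ and all $o$ in the common prefix of $j$ and $k$. *)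

theory Defs
  imports "HOL-Analysis.Analysis" "HOL-Library.While_Combinator"
begin

section \<open>Preferences\<close>

text \<open>
  The finite types \<open>'a\<close> and \<open>'i\<close> are the sets of agents and of items. A strict preference is a
  relation \<open>r\<close> in which \<open>(x, y) \<in> r\<close> means that \<open>x\<close> is strictly better than \<open>y\<close>.
\<close>

type_synonym ('a, 'i) profile = "'a \<Rightarrow> 'i rel"

type_synonym ('a, 'i) assignment = "'a \<Rightarrow> 'i \<Rightarrow> real"

type_synonym ('a, 'i) mechanism = "('a, 'i) profile \<Rightarrow> ('a, 'i) assignment"

definition preference_profile :: "('a, 'i) profile \<Rightarrow> bool" where
  "preference_profile R \<longleftrightarrow> (\<forall>j. strict_linear_order_on UNIV (R j))"

definition top_item :: "'i rel \<Rightarrow> 'i set \<Rightarrow> 'i" where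
  "top_item r S = (THE x. x \<in> S \<and> (\<forall>y\<in>S - {x}. (x, y) \<in> r))"

definition upper_set :: "'i rel \<Rightarrow> 'i \<Rightarrow> 'i set" where
  "upper_set r x = {y. (y, x) \<in> r} \<union> {x}"

definition pref_rank :: "'i rel \<Rightarrow> 'i \<Rightarrow> nat" where
  "pref_rank r x = card (upper_set r x)"

section \<open>Probabilistic respecting eagerness\<close>

text \<open>Only the values at nonnegative times matter.\<close>

definition eating_speeds :: "('a \<Rightarrow> real \<Rightarrow> real) \<Rightarrow> bool" where
  "eating_speeds \<omega> \<longleftrightarrow>
     (\<forall>j. (\<forall>t\<ge>0. \<omega> j t \<ge> 0) \<and> (\<omega> j has_integral 1) {0..1} \<and> (\<forall>t>1. \<omega> j t = 0))"

record ('a, 'i) pre_state =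
  items :: "'i set"
  alloc :: "('a, 'i) assignment"
  remaining :: "'i \<Rightarrow> real"
  elapsed :: "'a \<Rightarrow> real"

definition initial_state :: "('a, 'i) pre_state" where
  "initial_state =
     \<lparr>items = UNIV, alloc = (\<lambda>_ _. 0), remaining = (\<lambda>_. 1), elapsed = (\<lambda>_. 0)\<rparr>"

definition eaters :: "('a, 'i) profile \<Rightarrow> ('a, 'i) pre_state \<Rightarrow> 'i \<Rightarrow> 'a set" where
  "eaters R st x = {j. top_item (R j) (items st) = x}"

definition eaten ::
    "('a \<Rightarrow> real \<Rightarrow> real) \<Rightarrow> ('a, 'i) pre_state \<Rightarrow> real \<Rightarrow> 'a \<Rightarrow> real" where
  "eaten \<omega> st \<rho> j = integral {elapsed st j..elapsed st j + \<rho>} (\<omega> j)"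

text \<open>
  An elapsed time may exceed 1; then \<open>{elapsed st k..1}\<close> is empty and the integral over it is 0.
  This agrees with the oriented integral, since the speeds vanish after time 1.
\<close>

definition duration ::
    "('a::finite \<Rightarrow> real \<Rightarrow> real) \<Rightarrow> ('a, 'i) profile \<Rightarrow> ('a, 'i) pre_state \<Rightarrow> 'i \<Rightarrow> real" where
  "duration \<omega> R st x =
     (LEAST \<rho>. \<rho> \<in>
        {\<rho>. \<rho> \<ge> 0 \<and> (\<Sum>k\<in>eaters R st x. eaten \<omega> st \<rho> k) = remaining st x} \<union>
        {\<rho>\<in>{0..1}. (\<Sum>k\<in>eaters R st x. eaten \<omega> st \<rho> k) =
                    (\<Sum>k\<in>eaters R st x. integral {elapsed st k..1} (\<omega> k))})"

definition pre_round ::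
    "('a::finite \<Rightarrow> real \<Rightarrow> real) \<Rightarrow> ('a, 'i) profile \<Rightarrow> ('a, 'i) pre_state \<Rightarrow> ('a, 'i) pre_state"
  where
  "pre_round \<omega> R st =
     (let consumed = (\<lambda>j x. if x \<in> items st \<and> j \<in> eaters R st x
                            then eaten \<omega> st (duration \<omega> R st x) j else 0);
          remaining' = (\<lambda>x. remaining st x - (\<Sum>j\<in>UNIV. consumed j x))
      in \<lparr>items = items st - {x. remaining' x = 0},
          alloc = (\<lambda>j x. alloc st j x + consumed j x),
          remaining = remaining',
          elapsed = (\<lambda>j. elapsed st j + duration \<omega> R st (top_item (R j) (items st)))\<rparr>)"

definition PRE :: "('a::finite \<Rightarrow> real \<Rightarrow> real) \<Rightarrow> ('a, 'i) mechanism" where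
  "PRE \<omega> R = alloc (while (\<lambda>st. items st \<noteq> {}) (pre_round \<omega> R) initial_state)"

definition uniform_speeds :: "'a \<Rightarrow> real \<Rightarrow> real" where
  "uniform_speeds j t = (if t \<in> {0..1} then 1 else 0)"

lemma eating_speeds_uniform: "eating_speeds uniform_speeds"
proof -
  have "(uniform_speeds j has_integral 1) {0..1}" for j :: 'a
  proof (rule has_integral_eq[of _ "\<lambda>_. 1"])
    show "((\<lambda>_. 1) has_integral (1::real)) {0..1::real}"
      using has_integral_const_real[of "1::real" 0 1] by simp
  qed (simp add: uniform_speeds_def)
  then show ?thesis
    by (auto simp: eating_speeds_def uniform_speeds_def)
qed

definition UPRE :: "('a::finite, 'i) mechanism" where
  "UPRE = PRE uniform_speeds"

section \<open>Fairness properties\<close>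

definition sd_dominates :: "'i::finite rel \<Rightarrow> ('i \<Rightarrow> real) \<Rightarrow> ('i \<Rightarrow> real) \<Rightarrow> bool" where
  "sd_dominates r p q \<longleftrightarrow> (\<forall>x. (\<Sum>y\<in>upper_set r x. p y) \<ge> (\<Sum>y\<in>upper_set r x. q y))"

definition sd_WEF :: "('a, 'i::finite) profile \<Rightarrow> ('a, 'i) assignment \<Rightarrow> bool" where
  "sd_WEF R P \<longleftrightarrow> (\<forall>j k. sd_dominates (R j) (P k) (P j) \<longrightarrow> P j = P k)"

text \<open>
  For distinct preferences exactly one set satisfies the two conditions below: the items ranked
  before the first position at which the two orders differ.
\<close>

definition common_prefix :: "'i::finite rel \<Rightarrow> 'i rel \<Rightarrow> 'i set" where
  "common_prefix r r' =
     (if r = r' then UNIV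
      else (THE S. (\<forall>x\<in>S. pref_rank r x = pref_rank r' x \<and> pref_rank r x \<le> card S) \<and>
                   top_item r (- S) \<noteq> top_item r' (- S)))"

definition SETE :: "('a, 'i::finite) profile \<Rightarrow> ('a, 'i) assignment \<Rightarrow> bool" where
  "SETE R P \<longleftrightarrow> (\<forall>j k. \<forall>x\<in>common_prefix (R j) (R k). P j x = P k x)"

definition satisfies ::
    "('a, 'i) mechanism \<Rightarrow> (('a, 'i) profile \<Rightarrow> ('a, 'i) assignment \<Rightarrow> bool) \<Rightarrow> bool" where
  "satisfies f property \<longleftrightarrow> (\<forall>R. preference_profile R \<longrightarrow> property R (f R))"

end

theory Submission
  imports Defs
begin

text \<open>
  Under uniform speeds, an agent with residual demand \<open>d\<close> that eats for a time \<open>\<rho>\<close> receives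
  \<open>min \<rho> d\<close>, and residual demand is one minus the total amount received. Hence two agents with
  equal rows so far keep equal rows while they point to the same item, which gives SETE.

  For sd-WEF, consider the first round in which agents \<open>j\<close>, \<open>k\<close> with equal rows and positive demand
  point to different items, and let \<open>x\<close> be the item of \<open>j\<close>. All items that \<open>j\<close> prefers to \<open>x\<close> are
  gone. Either \<open>x\<close> is exhausted in this round, and \<open>k\<close> gets no more of it; or \<open>j\<close> fills its whole
  demand with \<open>x\<close>, while \<open>k\<close> has just wasted part of the same demand on another item. In both cases
  \<open>k\<close> ends up with less of \<open>x\<close> than \<open>j\<close>, and so the row of \<open>k\<close> does not dominate that of \<open>j\<close>.
\<close>

section \<open>Linear orders and common prefixes\<close>

text \<open>A finite acyclic relation is well-founded, and since \<open>(x, y) \<in> r\<close> means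
  that \<open>x\<close> is better, a minimal element of \<open>S\<close> is its best item.\<close>

lemma top_item_props:
  fixes r :: "'i::finite rel"
  assumes "strict_linear_order_on UNIV r" "S \<noteq> {}"
  shows top_item_in: "top_item r S \<in> S"
    and top_item_best: "y \<in> S \<Longrightarrow> y \<noteq> top_item r S \<Longrightarrow> (top_item r S, y) \<in> r"
proof -
  have tr: "trans r" and ir: "irrefl r" and tot: "total r"
    using assms by (auto simp: strict_linear_order_on_def)
  have "wf r"
    using tr ir by (intro finite_acyclic_wf) (auto simp: acyclic_irrefl)
  then obtain x where x: "x \<in> S" "\<And>y. (y, x) \<in> r \<Longrightarrow> y \<notin> S"
    using assms(2) by (metis ex_in_conv wf_eq_minimal)
  have "x \<in> S \<and> (\<forall>y\<in>S - {x}. (x, y) \<in> r)"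
    using x tot by (auto simp: total_on_def)
  moreover have "z = x" if "z \<in> S \<and> (\<forall>y\<in>S - {z}. (z, y) \<in> r)" for z
    using that x by auto
  ultimately have "top_item r S \<in> S \<and> (\<forall>y\<in>S - {top_item r S}. (top_item r S, y) \<in> r)"
    unfolding top_item_def by (rule theI)
  then show "top_item r S \<in> S" "y \<in> S \<Longrightarrow> y \<noteq> top_item r S \<Longrightarrow> (top_item r S, y) \<in> r"
    by auto
qed

text \<open>Transitivity nests the upper sets and irreflexivity makes the inclusion strict; totality
  gives the converse.\<close>

lemma pref_rank_less_iff:
  fixes r :: "'i::finite rel"
  assumes "strict_linear_order_on UNIV r"
  shows "pref_rank r x < pref_rank r y \<longleftrightarrow> (x, y) \<in> r"
proof -
  have tr: "trans r" and ir: "irrefl r" and tot: "total r"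
    using assms by (auto simp: strict_linear_order_on_def)
  have less: "pref_rank r a < pref_rank r b" if "(a, b) \<in> r" for a b
    unfolding pref_rank_def
  proof (rule psubset_card_mono)
    have "b \<notin> upper_set r a"
      using that tr ir by (auto simp: upper_set_def irrefl_def dest: transD)
    moreover have "upper_set r a \<subseteq> upper_set r b"
      using that tr by (auto simp: upper_set_def dest: transD)
    ultimately show "upper_set r a \<subset> upper_set r b"
      by (auto simp: upper_set_def)
  qed simp
  show ?thesis
    using less[of x y] less[of y x] tot by (cases "x = y") (use ir in \<open>force simp: total_on_def irrefl_def\<close>)+
qed

lemma inj_pref_rank:
  fixes r :: "'i::finite rel"
  assumes "strict_linear_order_on UNIV r"
  shows "inj (pref_rank r)"
proof (rule injI)
  fix x y
  assume eq: "pref_rank r x = pref_rank r y"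
  have "total r"
    using assms by (auto simp: strict_linear_order_on_def)
  moreover have "(x, y) \<notin> r" "(y, x) \<notin> r"
    using eq pref_rank_less_iff[OF assms, of x y] pref_rank_less_iff[OF assms, of y x] by simp_all
  ultimately show "x = y"
    by (auto simp: total_on_def)
qed

section \<open>Initial segments ranked alike by two orders\<close>

text \<open>This is the first condition in \<open>common_prefix\<close> alone, so sets that could
  still be extended qualify, among them the empty set.\<close>

definition prefix_set :: "'i::finite rel \<Rightarrow> 'i rel \<Rightarrow> 'i set \<Rightarrow> bool" where
  "prefix_set r r' S \<longleftrightarrow> (\<forall>x\<in>S. pref_rank r x = pref_rank r' x \<and> pref_rank r x \<le> card S)"

text \<open>Ranks are distinct and positive, so at most \<open>card S\<close> items have rank at
  most \<open>card S\<close>, and \<open>S\<close> already supplies that many. Thus \<open>S\<close>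
  is an initial segment of the order.\<close>

lemma ranks_le_card_eq:
  fixes r :: "'i::finite rel"
  assumes "strict_linear_order_on UNIV r" "\<forall>x\<in>S. pref_rank r x \<le> card S"
  shows "S = {x. pref_rank r x \<le> card S}"
proof (rule card_seteq)
  show "S \<subseteq> {x. pref_rank r x \<le> card S}"
    using assms(2) by auto
  have "pref_rank r x \<noteq> 0" for x
    by (simp add: pref_rank_def upper_set_def)
  then have "pref_rank r ` {x. pref_rank r x \<le> card S} \<subseteq> {1..card S}"
    by (auto simp: Suc_le_eq)
  then have "card {x. pref_rank r x \<le> card S} \<le> card {1..card S}"
    using inj_pref_rank[OF assms(1)] by (intro card_inj_on_le) (auto intro: inj_on_subset)
  then show "card {x. pref_rank r x \<le> card S} \<le> card S"
    by simp
qed simp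

lemma top_item_rank_le:
  fixes r :: "'i::finite rel"
  assumes "strict_linear_order_on UNIV r" "x \<in> S"
  shows "pref_rank r (top_item r S) \<le> pref_rank r x"
  using top_item_best[OF assms(1), of S x] assms pref_rank_less_iff[OF assms(1)]
  by (cases "x = top_item r S") (auto intro: less_imp_le)

lemma prefix_set_commute: "prefix_set r r' S \<Longrightarrow> prefix_set r' r S"
  by (auto simp: prefix_set_def)

lemma prefix_set_top_item_in:
  fixes r :: "'i::finite rel"
  assumes "strict_linear_order_on UNIV r" "prefix_set r r' S" "x \<in> S" "x \<in> T"
  shows "top_item r T \<in> S"
proof -
  have "S = {x. pref_rank r x \<le> card S}"
    using assms(2) by (intro ranks_le_card_eq[OF assms(1)]) (auto simp: prefix_set_def)
  then have "y \<in> S \<longleftrightarrow> pref_rank r y \<le> card S" for y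
    by blast
  then show ?thesis
    using top_item_rank_le[OF assms(1,4)] assms(3) by (metis le_trans)
qed

text \<open>Both best items lie in the initial segment \<open>S\<close>, where the two rank
  functions coincide; each has least rank in its own order, so the ranks are equal. This is what
  keeps two agents on the same item while some item of their common prefix is left.\<close>

lemma prefix_set_top_item_eq:
  fixes r r' :: "'i::finite rel"
  assumes "strict_linear_order_on UNIV r" "strict_linear_order_on UNIV r'"
    and "prefix_set r r' S" "x \<in> S" "x \<in> T"
  shows "top_item r T = top_item r' T"
proof -
  have S: "top_item r T \<in> S" "top_item r' T \<in> S"
    using assms prefix_set_commute prefix_set_top_item_in by blast+
  have T: "top_item r T \<in> T" "top_item r' T \<in> T"
    using assms top_item_in by blast+
  have "pref_rank r (top_item r T) \<le> pref_rank r (top_item r' T)"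
    "pref_rank r' (top_item r' T) \<le> pref_rank r' (top_item r T)"
    using top_item_rank_le assms(1,2) T by blast+
  then have "pref_rank r (top_item r T) = pref_rank r (top_item r' T)"
    using S assms(3) by (simp add: prefix_set_def)
  then show ?thesis
    using inj_pref_rank[OF assms(1)] by (simp add: inj_eq)
qed

text \<open>As \<open>S\<close> is an initial segment, the items better than the best one outside
  \<open>S\<close> are exactly those of \<open>S\<close>.\<close>

lemma pref_rank_top_item_Compl:
  fixes r :: "'i::finite rel"
  assumes "strict_linear_order_on UNIV r" "\<forall>x\<in>S. pref_rank r x \<le> card S" "S \<noteq> UNIV"
  shows "pref_rank r (top_item r (- S)) = Suc (card S)"
proof -
  let ?t = "top_item r (- S)"
  have S: "S = {x. pref_rank r x \<le> card S}"
    using assms by (intro ranks_le_card_eq)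
  have t: "?t \<notin> S"
    using top_item_in[OF assms(1), of "- S"] assms(3) by auto
  have "(y, ?t) \<in> r \<longleftrightarrow> y \<in> S" for y
  proof
    show "y \<in> S" if "(y, ?t) \<in> r"
      using that pref_rank_less_iff[OF assms(1), of y ?t] top_item_rank_le[OF assms(1), of y "- S"]
      by auto
    show "(y, ?t) \<in> r" if "y \<in> S"
    proof -
      have "pref_rank r y \<le> card S" "\<not> pref_rank r ?t \<le> card S"
        using that t S by blast+
      then show ?thesis
        using pref_rank_less_iff[OF assms(1), of y ?t] by simp
    qed
  qed
  then have "upper_set r ?t = insert ?t S"
    by (auto simp: upper_set_def)
  then show ?thesis
    using t by (simp add: pref_rank_def)
qed

text \<open>The definite description in \<open>common_prefix\<close> needs a unique solution. A
  \<open>prefix_set\<close> of largest cardinality is one.\<close>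

lemma prefix_set_common_prefix:
  fixes r r' :: "'i::finite rel"
  assumes lin: "strict_linear_order_on UNIV r" "strict_linear_order_on UNIV r'" and "r \<noteq> r'"
  shows "prefix_set r r' (common_prefix r r')"
proof -
  let ?P = "\<lambda>S. prefix_set r r' S \<and> top_item r (- S) \<noteq> top_item r' (- S)"
  have "prefix_set r r' {}"
    by (simp add: prefix_set_def)
  then obtain S where S: "prefix_set r r' S" and max: "\<And>T. prefix_set r r' T \<Longrightarrow> card T \<le> card S"
    using ex_has_greatest_nat[of "prefix_set r r'" "{}" card "Suc CARD('i)"]
    by (auto simp: card_mono less_Suc_eq_le)
  have "S \<noteq> UNIV"
  proof
    assume "S = UNIV"
    then have "(x, y) \<in> r \<longleftrightarrow> (x, y) \<in> r'" for x y
      using S pref_rank_less_iff[OF lin(1), of x y] pref_rank_less_iff[OF lin(2), of x y]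
      by (simp add: prefix_set_def)
    then show False
      using \<open>r \<noteq> r'\<close> by auto
  qed
  \<comment> \<open>A shared best item outside \<open>S\<close> would have rank
    \<open>Suc (card S)\<close> in both orders, and inserting it would contradict the maximality of
    \<open>S\<close>.\<close>
  have "top_item r (- S) \<noteq> top_item r' (- S)"
  proof
    assume eq: "top_item r (- S) = top_item r' (- S)"
    let ?t = "top_item r (- S)"
    have t: "?t \<notin> S"
      using top_item_in[OF lin(1), of "- S"] \<open>S \<noteq> UNIV\<close> by auto
    have "\<forall>x\<in>S. pref_rank r x \<le> card S" "\<forall>x\<in>S. pref_rank r' x \<le> card S"
      using S by (auto simp: prefix_set_def)
    then have "pref_rank r ?t = Suc (card S)" "pref_rank r' ?t = Suc (card S)"
      using pref_rank_top_item_Compl[OF lin(1), of S] pref_rank_top_item_Compl[OF lin(2), of S]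
        \<open>S \<noteq> UNIV\<close> eq by simp_all
    then have "prefix_set r r' (insert ?t S)"
      using S t by (auto simp: prefix_set_def)
    then show False
      using max t by fastforce
  qed
  then have PS: "?P S"
    using S by simp
  moreover have "T = S" if "?P T" for T
  proof -
    \<comment> \<open>Uniqueness: if \<open>A\<close> is the smaller set, some item of
      \<open>B\<close> lies outside \<open>A\<close>, and \<open>prefix_set_top_item_eq\<close> for
      \<open>B\<close> then makes the best items outside \<open>A\<close> coincide.\<close>
    have sub: "A = B" if "?P A" "?P B" "card A \<le> card B" for A B
    proof (rule ccontr)
      assume "A \<noteq> B"
      have "\<not> B \<subseteq> A"
      proof
        assume "B \<subseteq> A"
        then have "B = A"
          using that(3) by (intro card_seteq) auto
        then show False
          using \<open>A \<noteq> B\<close> by simp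
      qed
      then obtain x where "x \<in> B" "x \<in> - A"
        by auto
      then have "top_item r (- A) = top_item r' (- A)"
        using that(2) prefix_set_top_item_eq[OF lin] by blast
      then show False
        using that(1) by simp
    qed
    show ?thesis
      using sub[of S T] sub[of T S] that PS by (cases "card S \<le> card T") auto
  qed
  ultimately have "?P (THE S. ?P S)"
    by (rule theI[of ?P S])
  moreover have "common_prefix r r' = (THE S. ?P S)"
    unfolding common_prefix_def prefix_set_def using \<open>r \<noteq> r'\<close> by (rule if_not_P)
  ultimately show ?thesis
    by metis
qed

lemma common_prefix_top_item_eq:
  fixes r r' :: "'i::finite rel"
  assumes "strict_linear_order_on UNIV r" "strict_linear_order_on UNIV r'"
    and "x \<in> common_prefix r r'" "x \<in> T"
  shows "top_item r T = top_item r' T"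
  using assms prefix_set_top_item_eq prefix_set_common_prefix by (cases "r = r'") blast+

section \<open>A single round under uniform speeds\<close>

text \<open>The truncation at 0 covers agents whose elapsed time exceeds 1.\<close>

definition demand :: "('a, 'i) pre_state \<Rightarrow> 'a \<Rightarrow> real" where
  "demand st j = max 0 (1 - elapsed st j)"

lemma integral_uniform_speeds:
  assumes "0 \<le> a"
  shows "integral {a..b} (uniform_speeds j) = max 0 (min 1 b - a)"
proof -
  have "integral {a..b} (uniform_speeds j) = integral {a..b} (\<lambda>t. if t \<in> {0..1} then 1 else 0)"
    by (simp add: uniform_speeds_def[abs_def])
  also have "\<dots> = integral ({0..1} \<inter> {a..b}) (\<lambda>t. 1)"
    by (rule integral_restrict_Int)
  also have "{0..1} \<inter> {a..b} = {a..min 1 b}"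
    using assms by auto
  finally show ?thesis
    by (simp add: max_def)
qed

lemma eaten_uniform_speeds:
  assumes "0 \<le> elapsed st j" "0 \<le> \<rho>"
  shows "eaten uniform_speeds st \<rho> j = min \<rho> (demand st j)"
  using assms by (auto simp: eaten_def integral_uniform_speeds demand_def)

text \<open>A \<open>LEAST\<close> over the reals must be shown to be attained. Total consumption is
  continuous in the duration, so the admissible set \<open>A\<close> is closed; it is bounded below
  by 0 and contains 1, as demands are at most 1. Hence the least element is
  \<open>Inf A\<close>.\<close>

lemma duration_uniform_speeds:
  fixes R :: "('a::finite, 'i::finite) profile"
  assumes el: "\<And>j. 0 \<le> elapsed st j" and pos: "0 < remaining st x"
  defines "\<rho> \<equiv> duration uniform_speeds R st x"
  shows duration_nonneg: "0 \<le> \<rho>"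
    and duration_le_remaining: "(\<Sum>k\<in>eaters R st x. min \<rho> (demand st k)) \<le> remaining st x"
    and duration_exhausts:
      "j \<in> eaters R st x \<Longrightarrow> \<rho> < demand st j \<Longrightarrow>
        (\<Sum>k\<in>eaters R st x. min \<rho> (demand st k)) = remaining st x"
    and duration_pos: "j \<in> eaters R st x \<Longrightarrow> 0 < demand st j \<Longrightarrow> 0 < \<rho>"
proof -
  define N where "N = eaters R st x"
  define F where "F = (\<lambda>\<rho>. \<Sum>k\<in>N. min \<rho> (demand st k))"
  define D where "D = (\<Sum>k\<in>N. demand st k)"
  define A where "A = {\<rho>\<in>{0..}. F \<rho> = remaining st x} \<union> {\<rho>\<in>{0..1}. F \<rho> = D}"
  have d0: "0 \<le> demand st k" and d1: "demand st k \<le> 1" for k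
    using el[of k] by (auto simp: demand_def)
  have "integral {elapsed st k..1} (uniform_speeds k) = demand st k" for k
    using el[of k] by (simp add: integral_uniform_speeds demand_def)
  then have A: "A = {\<rho>. \<rho> \<ge> 0 \<and> (\<Sum>k\<in>N. eaten uniform_speeds st \<rho> k) = remaining st x} \<union>
        {\<rho>\<in>{0..1}. (\<Sum>k\<in>N. eaten uniform_speeds st \<rho> k) =
                    (\<Sum>k\<in>N. integral {elapsed st k..1} (uniform_speeds k))}"
    using el by (auto simp: A_def F_def D_def eaten_uniform_speeds)
  have cont: "continuous_on S F" for S
    unfolding F_def by (intro continuous_intros)
  have "F 1 = D"
    using d1 by (simp add: F_def D_def min_absorb2)
  have F0: "F 0 = 0"
    using d0 by (simp add: F_def min_absorb1)
  have "A \<noteq> {}"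
    using \<open>F 1 = D\<close> by (auto simp: A_def)
  have bdd: "bdd_below A"
    by (rule bdd_belowI[of _ 0]) (auto simp: A_def)
  have "closed A"
    unfolding A_def
    by (intro closed_Un continuous_closed_preimage_constant cont closed_atLeast closed_atLeastAtMost)
  then have "Inf A \<in> A"
    using \<open>A \<noteq> {}\<close> bdd by (intro closed_contains_Inf)
  then have "(LEAST \<rho>. \<rho> \<in> A) = Inf A"
    using bdd by (intro Least_equality) (auto intro: cInf_lower)
  then have \<rho>: "\<rho> = Inf A"
    by (simp add: \<rho>_def duration_def A N_def)
  have \<rho>A: "\<rho> \<in> A" and least: "\<And>\<sigma>. \<sigma> \<in> A \<Longrightarrow> \<rho> \<le> \<sigma>"
    using \<open>Inf A \<in> A\<close> bdd by (auto simp: \<rho> intro: cInf_lower)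
  show "0 \<le> \<rho>"
    using \<rho>A by (auto simp: A_def)
  \<comment> \<open>Overshooting the supply would, by the intermediate value theorem from
    \<open>F 0 = 0\<close>, give an earlier time of exact exhaustion.\<close>
  have "F \<rho> \<le> remaining st x"
  proof (rule ccontr)
    assume "\<not> F \<rho> \<le> remaining st x"
    then obtain \<sigma> where "0 \<le> \<sigma>" "\<sigma> \<le> \<rho>" "F \<sigma> = remaining st x"
      using IVT'[of F 0 "remaining st x" \<rho>] F0 pos \<open>0 \<le> \<rho>\<close> cont by auto
    then show False
      using least[of \<sigma>] \<open>\<not> F \<rho> \<le> remaining st x\<close> by (auto simp: A_def)
  qed
  then show "(\<Sum>k\<in>eaters R st x. min \<rho> (demand st k)) \<le> remaining st x"
    by (simp add: F_def N_def)
  \<comment> \<open>One unsatisfied eater keeps consumption strictly below total demand, so only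
    exhaustion can account for membership in \<open>A\<close>.\<close>
  have lt: "F \<sigma> < D" if "j \<in> N" "\<sigma> < demand st j" for j \<sigma>
    unfolding F_def D_def using that by (intro sum_strict_mono_ex1) (auto intro!: bexI[of _ j])
  show "(\<Sum>k\<in>eaters R st x. min \<rho> (demand st k)) = remaining st x"
    if "j \<in> eaters R st x" "\<rho> < demand st j"
    using lt[of j \<rho>] that \<rho>A by (auto simp: A_def N_def F_def)
  show "0 < \<rho>" if "j \<in> eaters R st x" "0 < demand st j"
    using lt[of j 0] that \<rho>A \<open>0 \<le> \<rho>\<close> F0 pos by (auto simp: A_def N_def less_le)
qed

section \<open>Conservation laws and the effect of one round\<close>

text \<open>The row sums make residual demand a function of an agent's row; the column sums give the
  conservation of supply on which termination rests.\<close>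

definition feasible :: "('a::finite, 'i::finite) pre_state \<Rightarrow> bool" where
  "feasible st \<longleftrightarrow>
     (\<forall>j. 0 \<le> elapsed st j) \<and>
     (\<forall>x. 0 \<le> remaining st x) \<and>
     items st = {x. 0 < remaining st x} \<and>
     (\<forall>j. (\<Sum>x\<in>UNIV. alloc st j x) = 1 - demand st j) \<and>
     (\<forall>x. (\<Sum>j\<in>UNIV. alloc st j x) = 1 - remaining st x)"

lemma feasible_initial_state: "feasible initial_state"
  by (simp add: feasible_def initial_state_def demand_def)

lemma feasible_demand_cong:
  assumes "feasible st" "alloc st j = alloc st k"
  shows "demand st j = demand st k"
  using assms unfolding feasible_def by (metis add_diff_cancel_left' diff_diff_eq2)

locale uniform_round =
  fixes R :: "('a::finite, 'i::finite) profile" and st :: "('a, 'i) pre_state"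
  assumes profile: "preference_profile R"
    and feasible: "feasible st"
    and nonempty: "items st \<noteq> {}"
begin

abbreviation "st' \<equiv> pre_round uniform_speeds R st"

definition "target j = top_item (R j) (items st)"

definition "share j = min (duration uniform_speeds R st (target j)) (demand st j)"

lemma lin: "strict_linear_order_on UNIV (R j)"
  using profile by (simp add: preference_profile_def)

lemma target_in: "target j \<in> items st"
  using top_item_in[OF lin nonempty] by (simp add: target_def)

lemma el: "0 \<le> elapsed st j"
  using feasible by (simp add: feasible_def)

lemma remaining_pos: "x \<in> items st \<Longrightarrow> 0 < remaining st x"
  using feasible by (auto simp: feasible_def)

lemma demand_nonneg: "0 \<le> demand st j"
  by (simp add: demand_def)

lemma eaters_iff: "j \<in> eaters R st x \<longleftrightarrow> x = target j"
  by (auto simp: eaters_def target_def)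

lemma duration_target_nonneg: "0 \<le> duration uniform_speeds R st (target j)"
  using duration_nonneg[OF el remaining_pos[OF target_in]] .

lemma share_nonneg: "0 \<le> share j"
  using duration_target_nonneg by (simp add: share_def demand_nonneg)

lemma share_le: "share j \<le> demand st j"
  by (simp add: share_def)

lemma share_pos: "0 < demand st j \<Longrightarrow> 0 < share j"
  using duration_pos[OF el remaining_pos[OF target_in], of j R j]
  by (simp add: share_def eaters_iff)

text \<open>The left side is the local \<open>consumed\<close> of \<open>pre_round\<close>; the
  membership test drops out because a target is always available.\<close>

lemma consumed_eq:
  "(if x \<in> items st \<and> j \<in> eaters R st x
    then eaten uniform_speeds st (duration uniform_speeds R st x) j else 0) =
   (if x = target j then share j else 0)"
  using target_in[of j] eaten_uniform_speeds[OF el duration_target_nonneg, of j]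
  by (auto simp: eaters_iff share_def)

lemma alloc_round: "alloc st' j x = alloc st j x + (if x = target j then share j else 0)"
  by (simp add: pre_round_def Let_def consumed_eq)

lemma remaining_round:
  "remaining st' x = remaining st x - (\<Sum>j\<in>UNIV. if x = target j then share j else 0)"
  by (simp add: pre_round_def Let_def consumed_eq)

lemma items_round: "items st' = items st - {x. remaining st' x = 0}"
  by (simp add: pre_round_def Let_def)

lemma elapsed_round: "elapsed st' j = elapsed st j + duration uniform_speeds R st (target j)"
  by (simp add: pre_round_def Let_def target_def)

lemma demand_round: "demand st' j = demand st j - share j"
  using duration_target_nonneg[of j] by (auto simp: demand_def share_def elapsed_round)

lemma sum_share:
  "(\<Sum>j\<in>UNIV. if x = target j then share j else 0) =
   (\<Sum>j\<in>eaters R st x. min (duration uniform_speeds R st x) (demand st j))"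
  by (rule sum.mono_neutral_cong_right) (auto simp: eaters_iff share_def)

lemma remaining_round_nonneg: "0 \<le> remaining st' x"
proof (cases "x \<in> items st")
  case True
  then show ?thesis
    using duration_le_remaining[OF el remaining_pos, of x R] by (simp add: remaining_round sum_share)
next
  case False
  then have "(\<Sum>j\<in>UNIV. if x = target j then share j else 0) = 0"
    using target_in by (intro sum.neutral) auto
  then show ?thesis
    using feasible by (simp add: remaining_round feasible_def)
qed

text \<open>An eater left with unmet demand forces its item to be exhausted and removed.\<close>

lemma share_eq_demand:
  assumes "target j \<in> items st'"
  shows "share j = demand st j"
proof (rule ccontr)
  assume "share j \<noteq> demand st j"
  then have "duration uniform_speeds R st (target j) < demand st j"
    by (auto simp: share_def min_def split: if_splits)
  then have "remaining st' (target j) = 0"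
    using duration_exhausts[OF el remaining_pos[OF target_in], of j R j]
    by (simp add: remaining_round sum_share eaters_iff)
  then show False
    using assms by (simp add: items_round)
qed

lemma feasible_round: "feasible st'"
proof -
  have "items st' = {x. 0 < remaining st' x}"
  proof -
    have "x \<in> items st' \<longleftrightarrow> 0 < remaining st' x" for x
    proof -
      have "remaining st' x \<le> remaining st x"
        using share_nonneg by (simp add: remaining_round sum_nonneg)
      moreover have "x \<in> items st \<longleftrightarrow> 0 < remaining st x"
        using feasible by (simp add: feasible_def)
      ultimately show ?thesis
        using remaining_round_nonneg[of x] by (auto simp: items_round)
    qed
    then show ?thesis
      by auto
  qed
  moreover have "(\<Sum>x\<in>UNIV. alloc st' j x) = 1 - demand st' j" for j
    using feasible by (simp add: alloc_round sum.distrib demand_round feasible_def)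
  moreover have "(\<Sum>j\<in>UNIV. alloc st' j x) = 1 - remaining st' x" for x
    using feasible by (simp add: alloc_round sum.distrib remaining_round feasible_def)
  ultimately show ?thesis
    using remaining_round_nonneg duration_target_nonneg el
    by (simp add: feasible_def elapsed_round)
qed

text \<open>
  If no item is exhausted, then every agent is satisfied, so the total consumption already equals
  the total supply.
\<close>

lemma items_round_psubset:
  assumes "CARD('a) = CARD('i)"
  shows "items st' \<subset> items st"
proof (rule ccontr)
  assume "\<not> items st' \<subset> items st"
  then have eq: "items st' = items st"
    by (auto simp: items_round)
  have "demand st' j = 0" for j
    using share_eq_demand[of j] target_in[of j] eq by (simp add: demand_round)
  then have "real CARD('a) = (\<Sum>j\<in>UNIV. \<Sum>x\<in>UNIV. alloc st' j x)"
    using feasible_round by (simp add: feasible_def)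
  also have "\<dots> = (\<Sum>x\<in>UNIV. \<Sum>j\<in>UNIV. alloc st' j x)"
    by (rule sum.swap)
  also have "\<dots> = real CARD('i) - (\<Sum>x\<in>UNIV. remaining st' x)"
    using feasible_round by (simp add: feasible_def sum_subtractf)
  finally have "(\<Sum>x\<in>UNIV. remaining st' x) = 0"
    using assms by simp
  then have "remaining st' x = 0" for x
    using remaining_round_nonneg by (simp add: sum_nonneg_eq_0_iff)
  then show False
    using eq nonempty by (auto simp: items_round)
qed

lemma alloc_round_cong:
  assumes "alloc st j = alloc st k" "target j = target k"
  shows "alloc st' j = alloc st' k"
  using assms feasible_demand_cong[OF feasible assms(1)] by (simp add: fun_eq_iff alloc_round share_def)

lemma alloc_round_absent: "x \<notin> items st \<Longrightarrow> alloc st' j x = alloc st j x"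
  using target_in[of j] by (auto simp: alloc_round)

end

section \<open>Invariants of the whole execution\<close>

text \<open>An induction principle for the loop: feasibility is carried along and the shrinking set
  of items gives termination, so each application supplies only its own invariant
  \<open>I\<close>.\<close>

lemma UPRE_rule:
  fixes R :: "('a::finite, 'i::finite) profile"
  assumes "CARD('a) = CARD('i)" "preference_profile R"
    and init: "I initial_state"
    and step: "\<And>st. uniform_round R st \<Longrightarrow> I st \<Longrightarrow> I (pre_round uniform_speeds R st)"
    and final: "\<And>st. items st = {} \<Longrightarrow> I st \<Longrightarrow> Q (alloc st)"
  shows "Q (UPRE R)"
  unfolding UPRE_def PRE_def
proof (rule while_rule[where P = "\<lambda>st. feasible st \<and> I st" and r = "inv_image less_than (\<lambda>st. card (items st))"])
  show "feasible initial_state \<and> I (initial_state :: ('a, 'i) pre_state)"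
    using feasible_initial_state init by simp
next
  fix st :: "('a, 'i) pre_state"
  assume st: "feasible st \<and> I st" "items st \<noteq> {}"
  then interpret uniform_round R st
    using assms(2) by unfold_locales auto
  show "feasible (pre_round uniform_speeds R st) \<and> I (pre_round uniform_speeds R st)"
    using feasible_round step[OF uniform_round_axioms] st by simp
  show "(pre_round uniform_speeds R st, st) \<in> inv_image less_than (\<lambda>st. card (items st))"
    using items_round_psubset[OF assms(1)] by (simp add: psubset_card_mono)
qed (use final in auto)

section \<open>Strong equal treatment of equals\<close>

text \<open>Rows may diverge only after all items of \<open>S\<close> are gone, and from then on the
  entries on \<open>S\<close> are frozen.\<close>

definition agree_on_prefix :: "'i set \<Rightarrow> 'a \<Rightarrow> 'a \<Rightarrow> ('a, 'i) pre_state \<Rightarrow> bool" where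
  "agree_on_prefix S j k st \<longleftrightarrow>
     alloc st j = alloc st k \<or>
     items st \<inter> S = {} \<and> (\<forall>x\<in>S. alloc st j x = alloc st k x)"

lemma (in uniform_round) agree_on_prefix_round:
  assumes "agree_on_prefix (common_prefix (R j) (R k)) j k st"
  shows "agree_on_prefix (common_prefix (R j) (R k)) j k st'"
proof (cases "items st \<inter> common_prefix (R j) (R k) = {}")
  case True
  then have "x \<notin> items st" if "x \<in> common_prefix (R j) (R k)" for x
    using that by blast
  then have "\<forall>x\<in>common_prefix (R j) (R k). alloc st' j x = alloc st' k x"
    using assms by (auto simp: agree_on_prefix_def alloc_round_absent)
  then show ?thesis
    using True by (auto simp: agree_on_prefix_def items_round)
next
  case False
  then have "target j = target k"
    using common_prefix_top_item_eq[OF lin lin] by (auto simp: target_def)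
  moreover have "alloc st j = alloc st k"
    using assms False unfolding agree_on_prefix_def by blast
  ultimately have "alloc st' j = alloc st' k"
    by (intro alloc_round_cong)
  then show ?thesis
    unfolding agree_on_prefix_def by blast
qed

section \<open>Weak envy-freeness\<close>

text \<open>
  The conditional term bounds what \<open>k\<close> may still receive of \<open>x\<close>.
\<close>

definition equal_or_unenvied ::
    "('a, 'i) profile \<Rightarrow> 'a \<Rightarrow> 'a \<Rightarrow> ('a, 'i) pre_state \<Rightarrow> bool" where
  "equal_or_unenvied R j k st \<longleftrightarrow>
     alloc st j = alloc st k \<or>
     (\<exists>x. (\<forall>y. (y, x) \<in> R j \<longrightarrow> y \<notin> items st \<and> alloc st j y = alloc st k y) \<and>
          alloc st k x + (if x \<in> items st then demand st k else 0) < alloc st j x)"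

text \<open>Equal rows stay equal when the targets coincide or the common demand is zero; otherwise
  a witness arises in this round. A witness, once found, persists.\<close>

lemma (in uniform_round) equal_or_unenvied_round:
  assumes "equal_or_unenvied R j k st"
  shows "equal_or_unenvied R j k st'"
proof (cases "alloc st j = alloc st k")
  case True
  note dem = feasible_demand_cong[OF feasible True]
  consider "target j = target k" | "demand st j = 0" | "target j \<noteq> target k" "0 < demand st j"
    using demand_nonneg[of j] by fastforce
  then show ?thesis
  proof cases
    case 1
    then show ?thesis
      using alloc_round_cong[OF True] by (simp add: equal_or_unenvied_def)
  next
    case 2
    then have "share j = 0" "share k = 0"
      using dem share_nonneg share_le by (metis order_antisym)+
    then have "alloc st' j = alloc st' k"
      using True by (simp add: fun_eq_iff alloc_round)
    then show ?thesis
      by (simp add: equal_or_unenvied_def)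
  next
    case 3
    let ?x = "target j"
    have "y \<notin> items st" if "(y, ?x) \<in> R j" for y
    proof
      assume "y \<in> items st"
      then have "pref_rank (R j) ?x \<le> pref_rank (R j) y"
        unfolding target_def by (rule top_item_rank_le[OF lin])
      then show False
        using that pref_rank_less_iff[OF lin[of j], of y ?x] by simp
    qed
    then have above: "\<forall>y. (y, ?x) \<in> R j \<longrightarrow> y \<notin> items st' \<and> alloc st' j y = alloc st' k y"
      using True by (auto simp: items_round alloc_round_absent)
    have "0 < share j" "0 < share k"
      using share_pos 3 dem by simp_all
    \<comment> \<open>If the item survives, \<open>j\<close> has filled the whole common demand with
      it, while \<open>k\<close> has spent a positive part of that demand elsewhere.\<close>
    moreover have "demand st' k < share j" if "?x \<in> items st'"
      using share_eq_demand[OF that] dem \<open>0 < share k\<close> by (simp add: demand_round)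
    ultimately have "alloc st' k ?x + (if ?x \<in> items st' then demand st' k else 0) < alloc st' j ?x"
      using 3 True by (simp add: alloc_round)
    then show ?thesis
      using above by (auto simp: equal_or_unenvied_def)
  qed
next
  case False
  then obtain x where
    above: "\<And>y. (y, x) \<in> R j \<Longrightarrow> y \<notin> items st \<and> alloc st j y = alloc st k y" and
    less: "alloc st k x + (if x \<in> items st then demand st k else 0) < alloc st j x"
    using assms by (auto simp: equal_or_unenvied_def)
  \<comment> \<open>The bound never grows: what \<open>k\<close> eats of \<open>x\<close> is
    deducted from its demand, eating elsewhere only lowers that demand, and a removed
    \<open>x\<close> is never eaten again.\<close>
  have "alloc st' k x + (if x \<in> items st' then demand st' k else 0) \<le>
        alloc st k x + (if x \<in> items st then demand st k else 0)"
    using target_in[of k] share_nonneg[of k] share_le[of k] demand_nonneg[of k]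
    by (auto simp: alloc_round demand_round items_round)
  also note less
  also have "alloc st j x \<le> alloc st' j x"
    using share_nonneg by (simp add: alloc_round)
  finally have "alloc st' k x + (if x \<in> items st' then demand st' k else 0) < alloc st' j x" .
  moreover have "y \<notin> items st' \<and> alloc st' j y = alloc st' k y" if "(y, x) \<in> R j" for y
    using above[OF that] by (simp add: alloc_round_absent items_round)
  ultimately show ?thesis
    unfolding equal_or_unenvied_def by blast
qed

text \<open>Dominance fails at the upper set of \<open>x\<close>, where the two sums differ only in
  the term at \<open>x\<close>.\<close>

lemma not_sd_dominates:
  assumes "strict_linear_order_on UNIV r"
    and "\<And>y. (y, x) \<in> r \<Longrightarrow> q y = p y" "p x < q x"
  shows "\<not> sd_dominates r p q"
proof -
  have x: "(x, x) \<notin> r"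
    using assms(1) by (auto simp: strict_linear_order_on_def irrefl_def)
  have "upper_set r x = insert x {y. (y, x) \<in> r}"
    by (auto simp: upper_set_def)
  then have "(\<Sum>y\<in>upper_set r x. p y) < (\<Sum>y\<in>upper_set r x. q y)"
    using assms(2,3) x by simp
  then show ?thesis
    unfolding sd_dominates_def by (metis leD)
qed

theorem theorem3:
  assumes "CARD('a::finite) = CARD('i::finite)"
  shows "satisfies (UPRE :: ('a, 'i) mechanism) sd_WEF \<and>
         satisfies (UPRE :: ('a, 'i) mechanism) SETE"
proof -
  {
    fix R :: "('a, 'i) profile"
    assume R: "preference_profile R"
    have lin: "strict_linear_order_on UNIV (R j)" for j
      using R by (simp add: preference_profile_def)
    have "sd_dominates (R j) (UPRE R k) (UPRE R j) \<longrightarrow> UPRE R j = UPRE R k" for j k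
    proof (rule UPRE_rule[OF assms R, where I = "equal_or_unenvied R j k"])
      show "equal_or_unenvied R j k initial_state"
        by (simp add: equal_or_unenvied_def initial_state_def)
      \<comment> \<open>With no items left the conditional term is 0, so the witness of the
        invariant satisfies the premises of \<open>not_sd_dominates\<close>.\<close>
      show "sd_dominates (R j) (alloc st k) (alloc st j) \<longrightarrow> alloc st j = alloc st k"
        if "items st = {}" "equal_or_unenvied R j k st" for st :: "('a, 'i) pre_state"
        using that not_sd_dominates[OF lin[of j], of _ "alloc st j" "alloc st k"]
        by (auto simp: equal_or_unenvied_def)
    qed (rule uniform_round.equal_or_unenvied_round)
    then have "sd_WEF R (UPRE R)"
      by (simp add: sd_WEF_def)
    moreover have "\<forall>x\<in>common_prefix (R j) (R k). UPRE R j x = UPRE R k x" for j k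
    proof (rule UPRE_rule[OF assms R, where I = "agree_on_prefix (common_prefix (R j) (R k)) j k"])
      show "agree_on_prefix (common_prefix (R j) (R k)) j k initial_state"
        by (simp add: agree_on_prefix_def initial_state_def)
      show "\<forall>x\<in>common_prefix (R j) (R k). alloc st j x = alloc st k x"
        if "agree_on_prefix (common_prefix (R j) (R k)) j k st" for st :: "('a, 'i) pre_state"
        using that by (auto simp: agree_on_prefix_def)
    qed (rule uniform_round.agree_on_prefix_round)
    then have "SETE R (UPRE R)"
      by (simp add: SETE_def)
    ultimately have "sd_WEF R (UPRE R)" "SETE R (UPRE R)" .
  }
  then show ?thesis
    by (simp add: satisfies_def)
qed

end
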